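(* Consider a downlink mmWave SWIPT network under the independent eavesdropping attack model (see context), with a given time switching ratio $\eta\in(0,1)$ and SINR threshold $\beta$. Then the eavesdropping success probability $P(C_{es})=P(SINR_{Eve}>\beta)$ that an eavesdropper can overhear the signal from a typical mmWave base station is $$ \begin{aligned} P(C_{es}) &= \Bigl(1-e^{-2\pi\lambda_b\frac{e^{-p}}{\beta_0^2}\left[1-\beta_0 a e^{-\beta_0 a}-e^{-\beta_0 a}\right]}\Bigr)\, e^{-k(\beta_0 d_0+p)}\,\bigl(1-e^{-\lambda_0 Q}\bigr)\\ &\quad+\Bigl(1-e^{-2\pi\lambda_b\frac{e^{-p}}{\beta_0^2}\left[1-\beta_0 b e^{-\beta_0 b}-e^{-\beta_0 b}\right]}\Bigr)\,\bigl(1-e^{-k(\beta_0 d_0+p)}\bigr)\, e^{-\lambda_0 Q}, \end{aligned} $$ where $$ Q=\mathbb{E}[l]\sqrt{c^2\tau^2-D^2\cos^2\theta}+\mathbb{E}[w]D|\cos\theta|+\mathbb{E}[l]\mathbb{E}[w]-\frac{\mathbb{E}[l](c\tau-D)}{4}-\frac{\mathbb{E}[l]^2\sqrt{c^2\tau^2-D^2}}{8D}, $$ $$ a=\left(\frac{\bigl((1-\eta)P_t-\beta\eta P_t\bigr)\,\mathbb{E}[G_e]\,c^2}{(\sigma_e^2+I)\,\beta\,(4\pi f_c)^2}\right)^{1/\alpha_L},\qquad b=\left(\frac{\bigl((1-\eta)P_t-\beta\eta P_t\bigr)\,\mathbb{E}[G_e]\,c^2}{(\sigma_e^2+I)\,\beta\,(4\pi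 f_c)^2\,\rho}\right)^{1/\alpha_N}. $$
   Context: Parameters: transmission power $P_t$ of a base station (BS); carrier frequency $f_c$; speed of light $c$; noise power $\sigma_e^2$ at the eavesdropper (Eve); mean antenna gain $\mathbb{E}[G_e]$ obtained by Eve; reflection coefficient $\rho$ (reflected power equals $\rho$ times incident power); path loss exponents $\alpha_L$ (line-of-sight, LOS) and $\alpha_N$ (reflection, i.e. non-line-of-sight); total interference power $I=\sum_{x\in\Phi_b\setminus b} I_{x,e}$ received by Eve from the BSs other than the target BS $b$, where $\Phi_b$ is the set of BSs (treated as a number; it is approximated by its mean over BSs in a disk around Eve). The BSs form a homogeneous Poisson point process of density $\lambda_b$. The centers of the rectangular obstacles/reflectors form a homogeneous Poisson point process of density $\lambda_0$, and their random lengths and widths have means $\mathbb{E}[l]$ and $\mathbb{E}[w]$. Put $\beta_0=\frac{2\lambda_0(\mathbb{E}[l]+\mathbb{E}[w])}{\pi}$ and $p=\lambda_0\mathbb{E}[l]\mathbb{E}[w]$, and $k=1-\int_0^1\int_{H_{min}}^{sH_u+(1-s)H_b} f_H(h)\,dh\,ds$, where $f_H$ is the PDF of the obstacle heights (which lie in $[H_{min},H_{max}]$), $H_b$ is the BS height and $H_u$ the receiver height. $d_0$ is the BS–Eve separation at which the LOS probability is evaluated; $D$, $\theta$ and $\tau$ are the separation, orientation angle and propagation delay parameters of the first-order reflection path. Model. (1) Time switching: the BS sends energy during a fraction $\eta$ of the time and confidential information during the fraction $1-\eta$. The energy signal acts as interference at Eve. Eavesdroppers act independently of each other and do not move. (2)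 Eve is covered either by a LOS signal (event $LOS_{Eve}$) or by a first-order reflection (event $Ref_{Eve}$), and $$P(C_{es})=P(SINR_{Eve}>\beta\mid LOS_{Eve})P(LOS_{Eve})+P(SINR_{Eve}>\beta\mid Ref_{Eve})P(Ref_{Eve}).$$ Here $P(LOS_{Eve})=P_{Los}(1-P_{Ref})$ and $P(Ref_{Eve})=P_{Ref}(1-P_{Los})$, where $P_{Los}=e^{-k(\beta_0 d_0+p)}$ is the probability that a LOS link exists, and $P_{Ref}=e^{-\lambda_0 Q}$ is the probability that an unblocked first-order reflection path exists, with $Q$ as in the claim. (3) The path loss at distance $d$ is $L(d)=\left(\frac{c}{4\pi f_c}\right)^2 d^{-\alpha}$, with $\alpha=\alpha_L$ for LOS and $\alpha=\alpha_N$ for reflection. With $d$ the (random) BS–Eve distance, $$SINR_{Eve}=\frac{(1-\eta)P_t\mathbb{E}[G_e]L(d)}{\eta P_t\mathbb{E}[G_e]L(d)+I+\sigma_e^2}\quad\text{given } LOS_{Eve},$$ $$SINR_{Eve}=\frac{(1-\eta)P_t\mathbb{E}[G_e]L(d)\rho}{\eta P_t\mathbb{E}[G_e]L(d)\rho+I+\sigma_e^2}\quad\text{given } Ref_{Eve}.$$ (4) In both cases the distance $d$ is taken to have the cumulative distribution function $$F_d(x)=1-e^{-2\pi\lambda_b\frac{e^{-p}}{\beta_0^2}\left(1-\beta_0 x e^{-\beta_0 x}-e^{-\beta_0 x}\right)}.$$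
   Formalization: In b the reflection coefficient ρ is put in the numerator under the root, as the model's SINR requires (the printed formula fails for ρ≠1); d may be infinite, since F_d has total mass below 1, and F_d is imposed only for x≥0; β>0 and (1-η)P_t-βηP_t≥0 are assumed so that a, b are defined. *)

theory Defs
  imports "HOL-Probability.Probability"
begin

text \<open>
  Homogeneous Poisson point process in the plane, as a random locally finite set:
  counts in bounded Borel sets are Poisson distributed with mean density times area, and
  counts in pairwise disjoint sets are independent.
\<close>

definition homogeneous_ppp :: "'w measure \<Rightarrow> ('w \<Rightarrow> (real ^ 2) set) \<Rightarrow> real \<Rightarrow> bool" where
  "homogeneous_ppp M \<Phi> lam \<longleftrightarrow>
     (\<forall>\<omega>\<in>space M. \<forall>B. bounded B \<longrightarrow> finite (\<Phi> \<omega> \<inter> B)) \<and>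
     (\<forall>B\<in>sets borel. bounded B \<longrightarrow>
        (\<lambda>\<omega>. card (\<Phi> \<omega> \<inter> B)) \<in> measurable M (count_space UNIV) \<and>
        (\<forall>n. \<P>(\<omega> in M. card (\<Phi> \<omega> \<inter> B) = n) =
               exp (- (lam * measure lborel B)) * (lam * measure lborel B) ^ n / fact n)) \<and>
     (\<forall>(m::nat) B. (\<forall>i<m. B i \<in> sets borel \<and> bounded (B i)) \<longrightarrow>
        disjoint_family_on B {..<m} \<longrightarrow>
        prob_space.indep_vars M (\<lambda>_. count_space UNIV) (\<lambda>i \<omega>. card (\<Phi> \<omega> \<inter> B i)) {..<m})"

text \<open>
  The distance from the receiver at position \<open>e\<close> to its target base station is
  extended-real valued, \<open>\<infinity>\<close> meaning that there is no such base station. This is needed: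
  \<open>distance_cdf\<close> below tends to \<open>1 - exp (- 2 \<pi> lam_b exp (- p) / \<beta>\<^sub>0\<^sup>2) < 1\<close> at infinity, so no
  real-valued random variable has it as its distribution function.
\<close>

definition target_distance :: "real ^ 2 \<Rightarrow> (real ^ 2) option \<Rightarrow> ereal" where
  "target_distance e t = (case t of None \<Rightarrow> \<infinity> | Some x \<Rightarrow> ereal (dist x e))"

definition distance_cdf :: "real \<Rightarrow> real \<Rightarrow> real \<Rightarrow> real \<Rightarrow> real" where
  "distance_cdf lam_b \<beta>\<^sub>0 p x =
     1 - exp (- (2 * pi * lam_b * (exp (- p) / \<beta>\<^sub>0\<^sup>2) *
                 (1 - \<beta>\<^sub>0 * x * exp (- (\<beta>\<^sub>0 * x)) - exp (- (\<beta>\<^sub>0 * x)))))"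

text \<open>
  Under the conditional distance laws used here, distance \<open>0\<close> (where \<open>powr\<close> returns \<open>0\<close>) has
  probability \<open>0\<close>.
\<close>

definition path_loss :: "real \<Rightarrow> real \<Rightarrow> real \<Rightarrow> ereal \<Rightarrow> real" where
  "path_loss c f\<^sub>c \<alpha> d =
     (if d = \<infinity> then 0 else (c / (4 * pi * f\<^sub>c))\<^sup>2 * real_of_ereal d powr (- \<alpha>))"

text \<open>
  SINR under time switching, for a channel power gain \<open>g\<close>: the path loss \<open>L d\<close> on a
  line-of-sight link and \<open>L d * \<rho>\<close> on a reflected link.
  The condition \<open>sinr_ts \<eta> P\<^sub>t G I\<^sub>e \<sigma>2 g > \<beta>\<close> reads
  \<open>g * ((1 - \<eta>) * P\<^sub>t - \<beta> * \<eta> * P\<^sub>t) * G > \<beta> * (\<sigma>2 + I\<^sub>e)\<close>. Hence the critical distance of a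
  reflected link has \<open>\<rho>\<close> in the numerator under the root; the formula in the source has \<open>\<rho>\<close> in
  the denominator there, which agrees with the model only for \<open>\<rho> = 1\<close>.
\<close>

definition sinr_ts :: "real \<Rightarrow> real \<Rightarrow> real \<Rightarrow> real \<Rightarrow> real \<Rightarrow> real \<Rightarrow> real" where
  "sinr_ts \<eta> P\<^sub>t G I\<^sub>e \<sigma>2 g = ((1 - \<eta>) * P\<^sub>t * G * g) / (\<eta> * P\<^sub>t * G * g + I\<^sub>e + \<sigma>2)"

end

theory Submission
  imports Defs
begin

text \<open>
  Given either kind of coverage, the SINR is a strictly decreasing function of the distance, so it
  exceeds the threshold exactly when the distance is positive and below a critical value. The
  conditional distance law is continuous and vanishes at \<open>0\<close>, so the conditional probability of
  this event is its value at the critical distance. Independence of the two links supplies the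
  weights of the two cases.
\<close>

text \<open>The denominator is positive, so the threshold can be cleared of it. Moving the
  energy-signal interference across then leaves a condition linear in the gain
  \<open>g\<close>.\<close>

lemma sinr_ts_gt_iff:
  assumes "0 < \<eta>" "0 < P" "0 < G" "0 \<le> I" "0 < \<sigma>2" "0 \<le> g"
  shows "sinr_ts \<eta> P G I \<sigma>2 g > \<beta> \<longleftrightarrow>
         \<beta> * (\<sigma>2 + I) < g * (((1 - \<eta>) * P - \<beta> * \<eta> * P) * G)"
proof -
  have "0 \<le> \<eta> * P * G * g" using assms by simp
  then have "0 < \<eta> * P * G * g + I + \<sigma>2" using assms by linarith
  then show ?thesis
    unfolding sinr_ts_def by (simp add: less_divide_eq algebra_simps)
qed

text \<open>The factor \<open>r\<close> lets one statement serve both links: \<open>1\<close> for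
  line of sight, \<open>\<rho>\<close> for a reflection. The linear condition on the gain is solved
  for the distance by taking an \<alpha>-th root, for which \<open>A\<close> keeps the base
  nonnegative. When the base is \<open>0\<close>, both sides are false.\<close>

lemma sinr_ts_path_loss_gt_iff:
  fixes d :: ereal
  assumes pos: "0 < \<eta>" "0 < P" "0 < G" "0 \<le> I" "0 < \<sigma>2" "0 < \<beta>" "0 < r" "0 < c" "0 < f" "0 < \<alpha>"
    and A: "0 \<le> (1 - \<eta>) * P - \<beta> * \<eta> * P" and d: "0 \<le> d"
  shows "sinr_ts \<eta> P G I \<sigma>2 (path_loss c f \<alpha> d * r) > \<beta> \<longleftrightarrow>
         0 < d \<and> d < ereal ((r * ((1 - \<eta>) * P - \<beta> * \<eta> * P) * G * c\<^sup>2 /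
                             ((\<sigma>2 + I) * \<beta> * (4 * pi * f)\<^sup>2)) powr (1 / \<alpha>))"
proof -
  define A where "A = (1 - \<eta>) * P - \<beta> * \<eta> * P"
  define S where "S = \<beta> * (\<sigma>2 + I)"
  define X where "X = r * A * G * c\<^sup>2 / ((\<sigma>2 + I) * \<beta> * (4 * pi * f)\<^sup>2)"
  have S: "0 < S" using pos by (simp add: S_def)
  have X0: "0 \<le> X" using pos A by (simp add: X_def A_def)
  have "0 \<le> path_loss c f \<alpha> d * r"
    using pos by (simp add: path_loss_def)
  then have gt: "sinr_ts \<eta> P G I \<sigma>2 (path_loss c f \<alpha> d * r) > \<beta> \<longleftrightarrow>
      S < path_loss c f \<alpha> d * r * (A * G)"
    unfolding S_def A_def using pos by (intro sinr_ts_gt_iff) auto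
  show ?thesis
  proof (cases d)
    case (real x)
    show ?thesis
    \<comment> \<open>At distance \<open>0\<close> the convention \<open>0 powr y = 0\<close> makes
      the gain vanish, so the threshold fails; this is why \<open>0 < d\<close> appears on the
      right.\<close>
    proof (cases "x = 0")
      case True
      then show ?thesis using gt S real by (simp add: path_loss_def)
    next
      case False
      then have x: "0 < x" using d real by simp
      have gain: "path_loss c f \<alpha> d * r * (A * G) = S * X / x powr \<alpha>"
      proof -
        define T where "T = (4 * pi * f)\<^sup>2"
        have "X = r * A * G * c\<^sup>2 / (S * T)"
          by (simp add: X_def S_def T_def mult.commute)
        moreover have "path_loss c f \<alpha> d = c\<^sup>2 / T / x powr \<alpha>"
          unfolding path_loss_def power_divide T_def[symmetric] using real by (simp add: powr_minus_divide)
        ultimately show ?thesis using S by simp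
      qed
      have "S < S * X / x powr \<alpha> \<longleftrightarrow> x powr \<alpha> < X"
        using S x by (simp add: less_divide_eq)
      also have "\<dots> \<longleftrightarrow> x < X powr (1 / \<alpha>)"
      proof -
        \<comment> \<open>Since \<open>X\<close> is nonnegative, it is the \<alpha>-th power of its
          root. Strict monotonicity of the power then gives one direction of the comparison, and
          weak monotonicity gives the other by contraposition.\<close>
        have "x powr \<alpha> < X \<longleftrightarrow> x powr \<alpha> < (X powr (1 / \<alpha>)) powr \<alpha>"
          using X0 pos by (simp add: powr_powr)
        also have "\<dots> \<longleftrightarrow> x < X powr (1 / \<alpha>)"
          using x pos powr_less_mono2[of \<alpha> x "X powr (1 / \<alpha>)"]
            powr_mono2[of \<alpha> "X powr (1 / \<alpha>)" x] by force
        finally show ?thesis .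
      qed
      finally show ?thesis using gt gain x real unfolding X_def A_def by simp
    qed
  next
    case PInf
    then show ?thesis using gt S by (simp add: path_loss_def)
  next
    case MInf
    then show ?thesis using d by simp
  qed
qed

text \<open>The given law speaks of \<open>d \<le> x\<close>, whereas the SINR event is strict at
  both ends. Continuity at \<open>a\<close> excludes an atom there, and \<open>F 0 = 0\<close>
  excludes one at \<open>0\<close>. Only finite arguments of the law enter, so \<open>d\<close> may
  be infinite with positive probability.\<close>

lemma (in prob_space) prob_less_from_continuous_cond_cdf:
  fixes d :: "'a \<Rightarrow> ereal" and F :: "real \<Rightarrow> real"
  assumes d[measurable]: "d \<in> borel_measurable M" and E[measurable]: "E \<in> sets M"
    and cdf: "\<And>x. prob E \<noteq> 0 \<Longrightarrow> 0 \<le> x \<Longrightarrow> \<P>(\<omega> in M. d \<omega> \<le> ereal x \<bar> \<omega> \<in> E) = F x"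
    and F: "isCont F a" "F 0 = 0" and a: "0 \<le> a"
  shows "\<P>(\<omega> in M. 0 < d \<omega> \<and> d \<omega> < ereal a \<and> \<omega> \<in> E) = F a * prob E"
proof (cases "a = 0")
  case True
  then have "{\<omega> \<in> space M. 0 < d \<omega> \<and> d \<omega> < ereal a \<and> \<omega> \<in> E} = {}"
    by (auto simp flip: zero_ereal_def)
  then have "\<P>(\<omega> in M. 0 < d \<omega> \<and> d \<omega> < ereal a \<and> \<omega> \<in> E) = 0"
    by (simp only: measure_empty)
  then show ?thesis using True F by simp
next
  case False
  with a have a: "0 < a" by simp
  have EM: "{\<omega> \<in> space M. \<omega> \<in> E} = E" using sets.sets_into_space[OF E] by auto
  \<comment> \<open>Multiplying the conditional law by \<open>prob E\<close> also covers a null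
    \<open>E\<close>, where the law is not assumed but both sides are \<open>0\<close>.\<close>
  have joint: "\<P>(\<omega> in M. d \<omega> \<le> ereal x \<and> \<omega> \<in> E) = F x * prob E" if "0 \<le> x" for x
  proof (cases "prob E = 0")
    case True
    have "\<P>(\<omega> in M. d \<omega> \<le> ereal x \<and> \<omega> \<in> E) \<le> prob E"
      by (intro finite_measure_mono) auto
    with True show ?thesis by (simp add: measure_le_0_iff)
  next
    case False
    with cdf[OF False that] show ?thesis by (simp add: cond_prob_def EM field_simps)
  qed
  \<comment> \<open>The sequence starts at \<open>0\<close> and increases to \<open>a\<close>
    without reaching it: nonnegativity makes \<open>joint\<close> applicable, and strictness makes
    the union of the closed events the open one.\<close>
  define x where "x n = a - a / real (Suc n)" for n
  have x0: "0 \<le> x n" for n using a by (simp add: x_def field_simps)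
  have xa: "x n < a" for n using a by (simp add: x_def)
  have "incseq x" using a by (auto simp: incseq_def x_def intro!: divide_left_mono)
  have lim: "x \<longlonglongrightarrow> a"
  proof -
    have "(\<lambda>n. a - a * (1 / real (Suc n))) \<longlonglongrightarrow> a - a * 0"
      by (intro tendsto_intros LIMSEQ_Suc[OF lim_1_over_n])
    then show ?thesis by (simp add: x_def[abs_def])
  qed
  define B where "B n = {\<omega> \<in> space M. d \<omega> \<le> ereal (x n) \<and> \<omega> \<in> E}" for n
  have "(\<lambda>n. prob (B n)) \<longlonglongrightarrow> prob (\<Union>n. B n)"
  proof (rule finite_Lim_measure_incseq)
    show "range B \<subseteq> sets M" by (auto simp: B_def)
    show "incseq B"
      using \<open>incseq x\<close> by (fastforce simp: incseq_def B_def intro: order_trans)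
  qed
  moreover have "(\<Union>n. B n) = {\<omega> \<in> space M. d \<omega> < ereal a \<and> \<omega> \<in> E}"
  proof -
    \<comment> \<open>If \<open>d \<omega>\<close> is below \<open>a\<close>, some real
      \<open>y\<close> lies between them, and \<open>x n\<close> eventually passes
      \<open>y\<close>.\<close>
    have "(\<exists>n. d \<omega> \<le> ereal (x n)) \<longleftrightarrow> d \<omega> < ereal a" for \<omega>
    proof
      assume "d \<omega> < ereal a"
      then obtain y where y: "d \<omega> < ereal y" "y < a"
        using ereal_dense2[of "d \<omega>" "ereal a"] by auto
      then have "eventually (\<lambda>n. y < x n) sequentially"
        using lim by (simp add: order_tendsto_iff)
      then obtain n where "y < x n" by (auto simp: eventually_sequentially)
      with y show "\<exists>n. d \<omega> \<le> ereal (x n)"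
        by (meson ereal_less_eq(3) less_imp_le order_trans)
    next
      assume "\<exists>n. d \<omega> \<le> ereal (x n)"
      then show "d \<omega> < ereal a" using xa by (meson ereal_less(2) le_less_trans less_ereal.simps(1))
    qed
    then show ?thesis by (auto simp: B_def)
  qed
  moreover have "(\<lambda>n. prob (B n)) \<longlonglongrightarrow> F a * prob E"
  proof -
    have "(\<lambda>n. F (x n)) \<longlonglongrightarrow> F a" using F(1) lim by (rule isCont_tendsto_compose)
    then show ?thesis by (simp add: B_def joint x0 tendsto_mult_right)
  qed
  ultimately have less: "\<P>(\<omega> in M. d \<omega> < ereal a \<and> \<omega> \<in> E) = F a * prob E"
    using LIMSEQ_unique by metis
  \<comment> \<open>The part of \<open>E\<close> with \<open>d\<close> at most \<open>0\<close> is
    null, so removing it below does not change the probability.\<close>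
  have zero: "\<P>(\<omega> in M. d \<omega> \<le> ereal 0 \<and> \<omega> \<in> E) = 0" using joint[of 0] F(2) by simp
  have "{\<omega> \<in> space M. 0 < d \<omega> \<and> d \<omega> < ereal a \<and> \<omega> \<in> E} =
      {\<omega> \<in> space M. d \<omega> < ereal a \<and> \<omega> \<in> E} - {\<omega> \<in> space M. d \<omega> \<le> ereal 0 \<and> \<omega> \<in> E}"
    by (auto simp: zero_ereal_def not_le)
  moreover have "prob ({\<omega> \<in> space M. d \<omega> < ereal a \<and> \<omega> \<in> E} -
      {\<omega> \<in> space M. d \<omega> \<le> ereal 0 \<and> \<omega> \<in> E}) = \<P>(\<omega> in M. d \<omega> < ereal a \<and> \<omega> \<in> E)"
    using zero by (intro measure_Diff_null_set) (auto simp: null_sets_def emeasure_eq_measure)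
  ultimately show ?thesis using less by simp
qed

lemma isCont_distance_cdf: "isCont (distance_cdf lam \<beta>\<^sub>0 p) x"
proof -
  have "distance_cdf lam \<beta>\<^sub>0 p = (\<lambda>x. 1 - exp (- (2 * pi * lam * (exp (- p) / \<beta>\<^sub>0\<^sup>2) *
      (1 - \<beta>\<^sub>0 * x * exp (- (\<beta>\<^sub>0 * x)) - exp (- (\<beta>\<^sub>0 * x))))))"
    by (simp add: fun_eq_iff distance_cdf_def)
  then show ?thesis by (simp only:) (intro continuous_intros)
qed

lemma distance_cdf_0: "distance_cdf lam \<beta>\<^sub>0 p 0 = 0"
  by (simp add: distance_cdf_def)

lemma (in prob_space) indep_eventD:
  assumes "indep_event A B"
  shows "A \<in> events" "B \<in> events" "prob (A \<inter> B) = prob A * prob B"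
proof -
  have indep: "indep_events (case_bool A B) UNIV"
    using assms by (simp add: indep_event_def)
  then have "range (case_bool A B) \<subseteq> events" by (simp add: indep_events_def)
  then show "A \<in> events" "B \<in> events" by (simp_all add: UNIV_bool)
  have "\<forall>J\<subseteq>UNIV. J \<noteq> {} \<longrightarrow> finite J \<longrightarrow>
      prob (\<Inter>j\<in>J. case_bool A B j) = (\<Prod>j\<in>J. prob (case_bool A B j))"
    using indep unfolding indep_events_def by (rule conjunct2)
  \<comment> \<open>Taking both Boolean indices turns the product over the family into the product
    of the two probabilities.\<close>
  from this[rule_format, of UNIV]
  show "prob (A \<inter> B) = prob A * prob B"
    by (simp add: UNIV_bool Int_commute mult.commute)
qed

text \<open>These are the weights of the two kinds of coverage, where exactly one of the links
  exists.\<close>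

lemma (in prob_space) prob_Diff_indep_event:
  assumes "indep_event A B"
  shows "prob (A - B) = prob A * (1 - prob B)" "prob (B - A) = (1 - prob A) * prob B"
  using indep_eventD[OF assms] by (simp_all add: finite_measure_Diff' Int_commute algebra_simps)

text \<open>The assumption \<open>roots_defined\<close> makes \<open>a\<close> and \<open>b\<close>
  genuine roots of nonnegative numbers; it says that \<beta> is at most
  \<open>(1 - \<eta>) / \<eta>\<close>, a ratio the SINR never exceeds. A stronger reflection
  lengthens the critical distance, hence \<open>\<rho>\<close> stands in the numerator of
  \<open>b\<close>.\<close>

theorem mainTheorem1:
  fixes M :: "'w measure"
    and \<Phi>\<^sub>b \<Phi>\<^sub>0 :: "'w \<Rightarrow> (real ^ 2) set"
    and eve :: "real ^ 2"
    and target :: "'w \<Rightarrow> (real ^ 2) option"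
    and l w H G\<^sub>e SINR :: "'w \<Rightarrow> real"
    and d :: "'w \<Rightarrow> ereal"
    and LosLink RefPath LOS\<^sub>E Ref\<^sub>E :: "'w set"
    and f\<^sub>H :: "real \<Rightarrow> real"
    and P\<^sub>t f\<^sub>c c \<sigma>2 \<rho> \<alpha>\<^sub>L \<alpha>\<^sub>N I\<^sub>e lam_b lam_0 \<eta> \<beta> :: real
    and H\<^sub>m\<^sub>i\<^sub>n H\<^sub>m\<^sub>a\<^sub>x H\<^sub>b H\<^sub>u d\<^sub>0 D \<theta> \<tau> :: real
    and \<beta>\<^sub>0 p k Q P\<^sub>L\<^sub>o\<^sub>s P\<^sub>R\<^sub>e\<^sub>f El Ew EG a b :: real
  assumes M: "prob_space M"
    and base_stations: "homogeneous_ppp M \<Phi>\<^sub>b lam_b" "lam_b > 0"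
    and obstacle_centers: "homogeneous_ppp M \<Phi>\<^sub>0 lam_0" "lam_0 > 0"
    and length: "integrable M l" "\<And>\<omega>. \<omega> \<in> space M \<Longrightarrow> l \<omega> > 0" "El = integral\<^sup>L M l"
    and width: "integrable M w" "\<And>\<omega>. \<omega> \<in> space M \<Longrightarrow> w \<omega> > 0" "Ew = integral\<^sup>L M w"
    and height: "\<And>h. f\<^sub>H h \<ge> 0" "distributed M lborel H (\<lambda>h. ennreal (f\<^sub>H h))"
      "\<And>\<omega>. \<omega> \<in> space M \<Longrightarrow> H\<^sub>m\<^sub>i\<^sub>n \<le> H \<omega> \<and> H \<omega> \<le> H\<^sub>m\<^sub>a\<^sub>x"
    and gain: "integrable M G\<^sub>e" "\<And>\<omega>. \<omega> \<in> space M \<Longrightarrow> G\<^sub>e \<omega> \<ge> 0"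
      "EG = integral\<^sup>L M G\<^sub>e" "EG > 0"
    and physical: "P\<^sub>t > 0" "f\<^sub>c > 0" "c > 0" "\<sigma>2 > 0" "\<rho> > 0" "\<alpha>\<^sub>L > 0" "\<alpha>\<^sub>N > 0" "I\<^sub>e \<ge> 0"
    and geometry: "H\<^sub>b > 0" "H\<^sub>u > 0" "d\<^sub>0 \<ge> 0" "D > 0" "D \<le> c * \<tau>"
    and ratio: "0 < \<eta>" "\<eta> < 1"
    and threshold: "\<beta> > 0"
    and roots_defined: "(1 - \<eta>) * P\<^sub>t - \<beta> * \<eta> * P\<^sub>t \<ge> 0"
    and \<beta>\<^sub>0: "\<beta>\<^sub>0 = 2 * lam_0 * (El + Ew) / pi"
    and p: "p = lam_0 * El * Ew"
    and k: "k = 1 - (LBINT s=0..1. (LBINT h=H\<^sub>m\<^sub>i\<^sub>n..(s * H\<^sub>u + (1 - s) * H\<^sub>b). f\<^sub>H h))"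
    and Q: "Q = El * sqrt (c\<^sup>2 * \<tau>\<^sup>2 - D\<^sup>2 * (cos \<theta>)\<^sup>2) + Ew * D * \<bar>cos \<theta>\<bar> + El * Ew
               - El * (c * \<tau> - D) / 4 - El\<^sup>2 * sqrt (c\<^sup>2 * \<tau>\<^sup>2 - D\<^sup>2) / (8 * D)"
    and link_probs: "P\<^sub>L\<^sub>o\<^sub>s = exp (- (k * (\<beta>\<^sub>0 * d\<^sub>0 + p)))" "P\<^sub>R\<^sub>e\<^sub>f = exp (- (lam_0 * Q))"
    and links: "LosLink \<in> sets M" "RefPath \<in> sets M"
      "measure M LosLink = P\<^sub>L\<^sub>o\<^sub>s" "measure M RefPath = P\<^sub>R\<^sub>e\<^sub>f"
      "prob_space.indep_event M LosLink RefPath"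
    and coverage: "LOS\<^sub>E = LosLink - RefPath" "Ref\<^sub>E = RefPath - LosLink"
    and target: "\<And>\<omega> x. \<omega> \<in> space M \<Longrightarrow> target \<omega> = Some x \<Longrightarrow> x \<in> \<Phi>\<^sub>b \<omega>"
    and distance: "d = (\<lambda>\<omega>. target_distance eve (target \<omega>))" "d \<in> borel_measurable M"
    and distance_LOS: "\<And>x. measure M LOS\<^sub>E \<noteq> 0 \<Longrightarrow> x \<ge> 0 \<Longrightarrow>
      \<P>(\<omega> in M. d \<omega> \<le> ereal x \<bar> \<omega> \<in> LOS\<^sub>E) = distance_cdf lam_b \<beta>\<^sub>0 p x"
    and distance_Ref: "\<And>x. measure M Ref\<^sub>E \<noteq> 0 \<Longrightarrow> x \<ge> 0 \<Longrightarrow>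
      \<P>(\<omega> in M. d \<omega> \<le> ereal x \<bar> \<omega> \<in> Ref\<^sub>E) = distance_cdf lam_b \<beta>\<^sub>0 p x"
    and SINR: "SINR = (\<lambda>\<omega>.
      if \<omega> \<in> LOS\<^sub>E then sinr_ts \<eta> P\<^sub>t EG I\<^sub>e \<sigma>2 (path_loss c f\<^sub>c \<alpha>\<^sub>L (d \<omega>))
      else if \<omega> \<in> Ref\<^sub>E then sinr_ts \<eta> P\<^sub>t EG I\<^sub>e \<sigma>2 (path_loss c f\<^sub>c \<alpha>\<^sub>N (d \<omega>) * \<rho>)
      else 0)"
    and a: "a = (((1 - \<eta>) * P\<^sub>t - \<beta> * \<eta> * P\<^sub>t) * EG * c\<^sup>2 /
                 ((\<sigma>2 + I\<^sub>e) * \<beta> * (4 * pi * f\<^sub>c)\<^sup>2)) powr (1 / \<alpha>\<^sub>L)"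
    and b: "b = (\<rho> * ((1 - \<eta>) * P\<^sub>t - \<beta> * \<eta> * P\<^sub>t) * EG * c\<^sup>2 /
                 ((\<sigma>2 + I\<^sub>e) * \<beta> * (4 * pi * f\<^sub>c)\<^sup>2)) powr (1 / \<alpha>\<^sub>N)"
  shows "\<P>(\<omega> in M. SINR \<omega> > \<beta>) =
      (1 - exp (- (2 * pi * lam_b * (exp (- p) / \<beta>\<^sub>0\<^sup>2) *
                   (1 - \<beta>\<^sub>0 * a * exp (- (\<beta>\<^sub>0 * a)) - exp (- (\<beta>\<^sub>0 * a))))))
        * exp (- (k * (\<beta>\<^sub>0 * d\<^sub>0 + p))) * (1 - exp (- (lam_0 * Q)))
    + (1 - exp (- (2 * pi * lam_b * (exp (- p) / \<beta>\<^sub>0\<^sup>2) *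
                   (1 - \<beta>\<^sub>0 * b * exp (- (\<beta>\<^sub>0 * b)) - exp (- (\<beta>\<^sub>0 * b))))))
        * (1 - exp (- (k * (\<beta>\<^sub>0 * d\<^sub>0 + p)))) * exp (- (lam_0 * Q))"
proof -
  interpret prob_space M by fact
  have [measurable]: "LOS\<^sub>E \<in> sets M" "Ref\<^sub>E \<in> sets M" "d \<in> borel_measurable M"
    using links coverage distance(2) by auto
  have d0: "0 \<le> d \<omega>" for \<omega>
    by (simp add: distance(1) target_distance_def split: option.split)
  have LOS: "SINR \<omega> > \<beta> \<longleftrightarrow> 0 < d \<omega> \<and> d \<omega> < ereal a" if "\<omega> \<in> LOS\<^sub>E" for \<omega>
    using sinr_ts_path_loss_gt_iff[of \<eta> P\<^sub>t EG I\<^sub>e \<sigma>2 \<beta> 1 c f\<^sub>c \<alpha>\<^sub>L "d \<omega>"]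
      ratio gain(4) physical threshold roots_defined d0 that
    unfolding SINR a by simp
  \<comment> \<open>The coverage events are disjoint, so on \<open>Ref\<^sub>E\<close> the
    definition of \<open>SINR\<close> reaches its second branch.\<close>
  have Ref: "SINR \<omega> > \<beta> \<longleftrightarrow> 0 < d \<omega> \<and> d \<omega> < ereal b" if "\<omega> \<in> Ref\<^sub>E" for \<omega>
    using sinr_ts_path_loss_gt_iff[of \<eta> P\<^sub>t EG I\<^sub>e \<sigma>2 \<beta> \<rho> c f\<^sub>c \<alpha>\<^sub>N "d \<omega>"]
      ratio gain(4) physical threshold roots_defined d0 that coverage
    unfolding SINR b by auto
  \<comment> \<open>Without coverage \<open>SINR\<close> has the default value \<open>0\<close>,
    below the positive threshold.\<close>
  have uncovered: "\<not> SINR \<omega> > \<beta>" if "\<omega> \<notin> LOS\<^sub>E" "\<omega> \<notin> Ref\<^sub>E" for \<omega>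
    using that threshold by (simp add: SINR)
  let ?A = "{\<omega> \<in> space M. 0 < d \<omega> \<and> d \<omega> < ereal a \<and> \<omega> \<in> LOS\<^sub>E}"
  let ?B = "{\<omega> \<in> space M. 0 < d \<omega> \<and> d \<omega> < ereal b \<and> \<omega> \<in> Ref\<^sub>E}"
  have "{\<omega> \<in> space M. SINR \<omega> > \<beta>} = ?A \<union> ?B"
    using LOS Ref uncovered by blast
  moreover have "prob (?A \<union> ?B) = prob ?A + prob ?B"
    proof (rule finite_measure_Union)
    show "?A \<inter> ?B = {}" using coverage by blast
  qed measurable
  \<comment> \<open>The critical distance is nonnegative because it is a value of
    \<open>powr\<close>, as the rule requires.\<close>
  moreover have "prob ?A = distance_cdf lam_b \<beta>\<^sub>0 p a * prob LOS\<^sub>E"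
    by (rule prob_less_from_continuous_cond_cdf)
      (use distance_LOS in \<open>auto simp: isCont_distance_cdf distance_cdf_0 a\<close>)
  moreover have "prob ?B = distance_cdf lam_b \<beta>\<^sub>0 p b * prob Ref\<^sub>E"
    by (rule prob_less_from_continuous_cond_cdf)
      (use distance_Ref in \<open>auto simp: isCont_distance_cdf distance_cdf_0 b\<close>)
  moreover have "prob LOS\<^sub>E = P\<^sub>L\<^sub>o\<^sub>s * (1 - P\<^sub>R\<^sub>e\<^sub>f)"
    using prob_Diff_indep_event[OF links(5)] links coverage by simp
  moreover have "prob Ref\<^sub>E = (1 - P\<^sub>L\<^sub>o\<^sub>s) * P\<^sub>R\<^sub>e\<^sub>f"
    using prob_Diff_indep_event[OF links(5)] links coverage by simp
  ultimately show ?thesis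
    by (simp add: distance_cdf_def link_probs mult.assoc)
qed

end
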